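(* Let $\star$ be a semistar operation on an integral domain $D$ such that $D$ is a P$\star$MD, and let $I$ be a quasi-$\star_f$-ideal of $D$. Then $I$ is $\star_f$-idempotent if and only if $I$ is a radical ideal each of whose minimal primes is $\star_f$-idempotent. In particular, if $D$ is a P$v$MD and $I$ is a $t$-ideal of $D$, then $I$ is $t$-idempotent if and only if $I$ is a radical ideal each of whose minimal primes is $t$-idempotent.
   Context: $D$ is an integral domain with quotient field $K$; $\overline{\boldsymbol F}(D)$ is the set of nonzero $D$-submodules of $K$, and $\boldsymbol f(D)$ the set of nonzero finitely generated $D$-submodules of $K$. A semistar operation on $D$ is a map $\star:\overline{\boldsymbol F}(D)\to\overline{\boldsymbol F}(D)$, $E\mapsto E^\star$, such that for all $0\ne x\in K$ and $E,F\in\overline{\boldsymbol F}(D)$: $(xE)^\star=xE^\star$; $E\subseteq F$ implies $E^\star\subseteq F^\star$; $E\subseteq E^\star$ and $(E^\star)^\star=E^\star$. The associated finite-type semistar operation is $E^{\star_f}=\bigcup\{F^\star\mid F\in\boldsymbol f(D),\,F\subseteq E\}$. For a semistar operation $*$, a quasi-$*$-ideal is a nonzero ideal $I$ of $D$ with $I=I^{*}\cap D$; $E\in\overline{\boldsymbol F}(D)$ is $*$-idempotent if $E^{*}=(E^2)^{*}$. $D$ is a P$\star$MD (Prüfer $\star$-multiplication domain) if $(FF^{-1})^{\star_f}=D^{\star_f}$ for each $F\in\boldsymbol f(D)$, where $F^{-1}=(D:F)=\{u\in K\mid uF\subseteq D\}$. For a nonzero fractional ideal $E$ of $D$: $E^{-1}=(D:E)$,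 $E^v=(E^{-1})^{-1}$, and $E^t=\bigcup\{F^v\mid F\in\boldsymbol f(D),\,F\subseteq E\}$. A $t$-ideal is a nonzero ideal $I$ with $I=I^t$; a nonzero ideal $I$ is $t$-idempotent if $I^t=(I^2)^t$. $D$ is a P$v$MD if $(FF^{-1})^t=D$ for every nonzero finitely generated ideal $F$ of $D$. The ideal $D$ is regarded as a radical ideal with no minimal primes. *)

theory Defs
  imports Main "HOL.Hull"
begin

text \<open>
  The quotient field \<open>K\<close> is a type \<open>'k\<close> of class \<^class>\<open>field\<close>, and the integral domain \<open>D\<close> is a
  subset of it; ideals of \<open>D\<close>, fractional ideals and \<open>D\<close>-submodules of \<open>K\<close> are then all sets
  over \<open>'k\<close>, so that expressions such as \<open>I\<^sup>\<star> \<inter> D\<close> can be taken literally.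
\<close>

definition domain_with_quotient_field :: "'k::field set \<Rightarrow> bool" where
  "domain_with_quotient_field D \<longleftrightarrow>
     1 \<in> D \<and> (\<forall>a\<in>D. \<forall>b\<in>D. a - b \<in> D) \<and> (\<forall>a\<in>D. \<forall>b\<in>D. a * b \<in> D) \<and>
     (\<forall>x. \<exists>a\<in>D. \<exists>b\<in>D. b \<noteq> 0 \<and> x = a / b)"

definition submod :: "'k::field set \<Rightarrow> 'k set \<Rightarrow> bool" where
  "submod D E \<longleftrightarrow> 0 \<in> E \<and> (\<forall>x\<in>E. \<forall>y\<in>E. x + y \<in> E) \<and> (\<forall>d\<in>D. \<forall>x\<in>E. d * x \<in> E)"

definition nonzero_submods :: "'k::field set \<Rightarrow> 'k set set" where
  "nonzero_submods D = {E. submod D E \<and> E \<noteq> {0}}"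

definition fg_submods :: "'k::field set \<Rightarrow> 'k set set" where
  "fg_submods D = {E \<in> nonzero_submods D. \<exists>S. finite S \<and> E = submod D hull S}"

definition ideal_of :: "'k::field set \<Rightarrow> 'k set \<Rightarrow> bool" where
  "ideal_of D I \<longleftrightarrow> submod D I \<and> I \<subseteq> D"

definition submod_mult :: "'k::field set \<Rightarrow> 'k set \<Rightarrow> 'k set \<Rightarrow> 'k set" where
  "submod_mult D E F = submod D hull {x * y | x y. x \<in> E \<and> y \<in> F}"

definition submod_inverse :: "'k::field set \<Rightarrow> 'k set \<Rightarrow> 'k set" where
  "submod_inverse D F = {u. \<forall>x\<in>F. u * x \<in> D}"


subsection \<open>Prime and radical ideals\<close>

definition prime_ideal_of :: "'k::field set \<Rightarrow> 'k set \<Rightarrow> bool" where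
  "prime_ideal_of D P \<longleftrightarrow>
     ideal_of D P \<and> P \<noteq> D \<and> (\<forall>a\<in>D. \<forall>b\<in>D. a * b \<in> P \<longrightarrow> a \<in> P \<or> b \<in> P)"

definition minimal_primes :: "'k::field set \<Rightarrow> 'k set \<Rightarrow> 'k set set" where
  "minimal_primes D I = {P. prime_ideal_of D P \<and> I \<subseteq> P \<and>
     (\<forall>Q. prime_ideal_of D Q \<and> I \<subseteq> Q \<and> Q \<subseteq> P \<longrightarrow> Q = P)}"

text \<open>The improper ideal \<open>D\<close> counts as a radical ideal; it has no minimal primes.\<close>

definition radical_ideal_of :: "'k::field set \<Rightarrow> 'k set \<Rightarrow> bool" where
  "radical_ideal_of D I \<longleftrightarrow> ideal_of D I \<and> I = {x \<in> D. \<exists>n>0. x ^ n \<in> I}"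


subsection \<open>Semistar operations\<close>

text \<open>
  A semistar operation is a map on the nonzero \<open>D\<close>-submodules of \<open>K\<close>; it is represented by a total
  function on sets, whose values at all other sets are unconstrained and never used.
\<close>

definition semistar_operation :: "'k::field set \<Rightarrow> ('k set \<Rightarrow> 'k set) \<Rightarrow> bool" where
  "semistar_operation D star \<longleftrightarrow>
     (\<forall>E\<in>nonzero_submods D. star E \<in> nonzero_submods D) \<and>
     (\<forall>x. \<forall>E\<in>nonzero_submods D. x \<noteq> 0 \<longrightarrow> star ((*) x ` E) = (*) x ` star E) \<and>
     (\<forall>E\<in>nonzero_submods D. \<forall>F\<in>nonzero_submods D. E \<subseteq> F \<longrightarrow> star E \<subseteq> star F) \<and>
     (\<forall>E\<in>nonzero_submods D. E \<subseteq> star E \<and> star (star E) = star E)"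

definition finite_type :: "'k::field set \<Rightarrow> ('k set \<Rightarrow> 'k set) \<Rightarrow> 'k set \<Rightarrow> 'k set" where
  "finite_type D star E = \<Union> {star F | F. F \<in> fg_submods D \<and> F \<subseteq> E}"

definition quasi_star_ideal :: "'k::field set \<Rightarrow> ('k set \<Rightarrow> 'k set) \<Rightarrow> 'k set \<Rightarrow> bool" where
  "quasi_star_ideal D star I \<longleftrightarrow> ideal_of D I \<and> I \<noteq> {0} \<and> I = star I \<inter> D"

definition star_idempotent :: "'k::field set \<Rightarrow> ('k set \<Rightarrow> 'k set) \<Rightarrow> 'k set \<Rightarrow> bool" where
  "star_idempotent D star E \<longleftrightarrow> E \<in> nonzero_submods D \<and> star E = star (submod_mult D E E)"

definition P_star_MD :: "'k::field set \<Rightarrow> ('k set \<Rightarrow> 'k set) \<Rightarrow> bool" where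
  "P_star_MD D star \<longleftrightarrow>
     (\<forall>F\<in>fg_submods D.
        finite_type D star (submod_mult D F (submod_inverse D F)) = finite_type D star D)"


subsection \<open>The \<open>v\<close>- and \<open>t\<close>-operations\<close>

definition v_closure :: "'k::field set \<Rightarrow> 'k set \<Rightarrow> 'k set" where
  "v_closure D E = submod_inverse D (submod_inverse D E)"

definition t_closure :: "'k::field set \<Rightarrow> 'k set \<Rightarrow> 'k set" where
  "t_closure D E = \<Union> {v_closure D F | F. F \<in> fg_submods D \<and> F \<subseteq> E}"

definition t_ideal :: "'k::field set \<Rightarrow> 'k set \<Rightarrow> bool" where
  "t_ideal D I \<longleftrightarrow> ideal_of D I \<and> I \<noteq> {0} \<and> I = t_closure D I"

definition t_idempotent :: "'k::field set \<Rightarrow> 'k set \<Rightarrow> bool" where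
  "t_idempotent D I \<longleftrightarrow>
     ideal_of D I \<and> I \<noteq> {0} \<and> t_closure D I = t_closure D (submod_mult D I I)"

definition PvMD :: "'k::field set \<Rightarrow> bool" where
  "PvMD D \<longleftrightarrow>
     (\<forall>F\<in>fg_submods D. F \<subseteq> D \<longrightarrow> t_closure D (submod_mult D F (submod_inverse D F)) = D)"

end

theory Submission
  imports Defs
begin

text \<open>
  Write \<open>*\<close> for the finite-type operation. Invertibility of \<open>L = (S)\<close> is used only through
  cancellation: if \<open>z s f \<in> X\<^sup>*\<close> for all \<open>s \<in> S\<close> and \<open>f \<in> L\<^sup>-\<^sup>1\<close>, then \<open>z \<in> X\<^sup>*\<close>.

  If \<open>I\<close> is idempotent and \<open>x\<^sup>2 \<in> I\<close>, then \<open>x\<^sup>2 \<in> (J\<^sup>2)\<^sup>*\<close> with \<open>J \<subseteq> I\<close> finitely generated, and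
  cancelling \<open>J + xD\<close> gives \<open>x \<in> J\<^sup>*\<close>; so \<open>I\<close> is radical. If \<open>P\<close> is a minimal prime of \<open>I\<close> and
  \<open>a \<in> P\<close>, then \<open>s a \<in> I\<close> for some \<open>s \<notin> P\<close>, so \<open>s a \<in> (J\<^sup>2)\<^sup>*\<close> as before, and cancelling
  \<open>J + sD\<close> gives \<open>a \<in> (P\<^sup>2)\<^sup>*\<close>, because \<open>J (J + sD)\<^sup>-\<^sup>1 \<subseteq> P\<close>.

  Conversely, if \<open>a \<in> I\<close> but \<open>a \<notin> (I\<^sup>2)\<^sup>*\<close>, take \<open>M\<close> containing \<open>{d \<in> D. d a \<in> (I\<^sup>2)\<^sup>*}\<close> and
  maximal among the ideals with \<open>1 \<notin> M\<^sup>*\<close>. As \<open>D\<^sub>M\<close> is a valuation domain and \<open>I\<close> is radical,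
  \<open>P = I D\<^sub>M \<inter> D\<close> is a minimal prime of \<open>I\<close>, and \<open>a \<in> (P\<^sup>2)\<^sup>*\<close> yields \<open>s\<^sup>2 a \<in> (I\<^sup>2)\<^sup>*\<close> for some
  \<open>s \<notin> M\<close>, a contradiction.
\<close>

subsection \<open>Submodules\<close>

lemma submod_Inter: "(\<And>E. E \<in> A \<Longrightarrow> submod D E) \<Longrightarrow> submod D (\<Inter>A)"
  unfolding submod_def by blast

lemma submod_hull: "submod D (submod D hull S)"
  by (rule hull_in) (simp add: submod_Inter)

lemma submodI:
  "(\<And>x y. x \<in> E \<Longrightarrow> y \<in> E \<Longrightarrow> x + y \<in> E) \<Longrightarrow>
    (\<And>d x. d \<in> D \<Longrightarrow> x \<in> E \<Longrightarrow> d * x \<in> E) \<Longrightarrow> 0 \<in> E \<Longrightarrow> submod D E"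
  unfolding submod_def by auto

lemma submod_zero: "submod D E \<Longrightarrow> 0 \<in> E"
  and submod_add: "submod D E \<Longrightarrow> x \<in> E \<Longrightarrow> y \<in> E \<Longrightarrow> x + y \<in> E"
  and submod_scale: "submod D E \<Longrightarrow> d \<in> D \<Longrightarrow> x \<in> E \<Longrightarrow> d * x \<in> E"
  unfolding submod_def by auto

text \<open>Together with \<open>hull_minimal\<close> this extends a condition
  \<open>z * w \<in> E\<close> from generators \<open>w\<close> to everything they generate.\<close>

lemma submod_vimage_times:
  "submod D E \<Longrightarrow> submod D {w. z * w \<in> E}"
  unfolding submod_def by (auto simp: distrib_left mult.left_commute)

lemma submod_image_times:
  assumes "submod D E"
  shows "submod D ((*) z ` E)"
proof -
  have "z * x + z * y \<in> (*) z ` E" if "x \<in> E" "y \<in> E" for x y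
    using submod_add[OF assms that] by (auto simp: distrib_left[symmetric])
  moreover have "d * (z * x) \<in> (*) z ` E" if "d \<in> D" "x \<in> E" for d x
    using submod_scale[OF assms that] by (auto simp: mult.left_commute)
  moreover have "0 \<in> (*) z ` E"
    using submod_zero[OF assms] by force
  ultimately show ?thesis
    unfolding submod_def by blast
qed

lemma hull_image_times:
  assumes "z \<noteq> (0::'k::field)"
  shows "submod D hull ((*) z ` S) = (*) z ` (submod D hull S)"
proof (rule hull_unique)
  show "(*) z ` S \<subseteq> (*) z ` (submod D hull S)"
    by (simp add: hull_subset image_mono)
  show "submod D ((*) z ` (submod D hull S))"
    by (simp add: submod_hull submod_image_times)
  fix T assume T: "(*) z ` S \<subseteq> T" "submod D T"
  have "submod D hull S \<subseteq> {w. z * w \<in> T}"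
    using T by (intro hull_minimal submod_vimage_times) auto
  then show "(*) z ` (submod D hull S) \<subseteq> T" by auto
qed

lemma nonzero_submodsI: "submod D E \<Longrightarrow> x \<in> E \<Longrightarrow> x \<noteq> 0 \<Longrightarrow> E \<in> nonzero_submods D"
  unfolding nonzero_submods_def by auto

lemma nonzero_submodsE:
  assumes "E \<in> nonzero_submods D"
  obtains x where "submod D E" "x \<in> E" "x \<noteq> 0"
  using assms unfolding nonzero_submods_def submod_def by auto

lemma nonzero_submods_hull:
  "x \<in> S \<Longrightarrow> x \<noteq> 0 \<Longrightarrow> submod D hull S \<in> nonzero_submods D"
  by (meson hull_inc nonzero_submodsI submod_hull)

section \<open>Nonzero finitely generated submodules\<close>

lemma fg_submodsI:
  "finite S \<Longrightarrow> x \<in> S \<Longrightarrow> x \<noteq> 0 \<Longrightarrow> submod D hull S \<in> fg_submods D"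
  unfolding fg_submods_def using nonzero_submods_hull by auto

lemma fg_submodsE:
  assumes "F \<in> fg_submods D"
  obtains S x where "finite S" "F = submod D hull S" "x \<in> S" "x \<noteq> 0"
proof -
  obtain S where S: "finite S" "F = submod D hull S" "F \<in> nonzero_submods D"
    using assms unfolding fg_submods_def by auto
  have "\<exists>x\<in>S. x \<noteq> 0"
  proof (rule ccontr)
    assume "\<not> (\<exists>x\<in>S. x \<noteq> 0)"
    then have "F \<subseteq> {0}"
      unfolding S(2) by (intro hull_minimal) (auto simp: submod_def)
    then show False using S(3) by (auto elim: nonzero_submodsE)
  qed
  then show thesis using that S by auto
qed

lemma fg_submods_nonzero: "F \<in> fg_submods D \<Longrightarrow> F \<in> nonzero_submods D"
  unfolding fg_submods_def by simp

lemma nonzero_submods_image_times: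
  "E \<in> nonzero_submods D \<Longrightarrow> z \<noteq> 0 \<Longrightarrow> (*) z ` E \<in> nonzero_submods D"
  by (auto elim!: nonzero_submodsE intro: nonzero_submodsI[of _ _ "z * x" for x] submod_image_times)

lemma fg_submods_image_times:
  assumes "F \<in> fg_submods D" "z \<noteq> 0"
  shows "(*) z ` F \<in> fg_submods D"
proof -
  obtain S x where "finite S" "F = submod D hull S" "x \<in> S" "x \<noteq> 0"
    using assms fg_submodsE by blast
  then show ?thesis
    using assms(2) fg_submodsI[of "(*) z ` S" "z * x" D] by (simp add: hull_image_times)
qed

section \<open>Products of submodules\<close>

lemma submod_mult_mem: "x \<in> E \<Longrightarrow> y \<in> F \<Longrightarrow> x * y \<in> submod_mult D E F"
  unfolding submod_mult_def by (rule hull_inc) blast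

lemma submod_submod_mult: "submod D (submod_mult D E F)"
  unfolding submod_mult_def by (rule submod_hull)

lemma submod_mult_subset:
  "submod D X \<Longrightarrow> (\<And>x y. x \<in> E \<Longrightarrow> y \<in> F \<Longrightarrow> x * y \<in> X) \<Longrightarrow> submod_mult D E F \<subseteq> X"
  unfolding submod_mult_def by (rule hull_minimal) auto

lemma submod_mult_mono:
  "E \<subseteq> E' \<Longrightarrow> F \<subseteq> F' \<Longrightarrow> submod_mult D E F \<subseteq> submod_mult D E' F'"
  by (rule submod_mult_subset) (auto intro: submod_mult_mem submod_submod_mult)

lemma nonzero_submods_mult:
  assumes "E \<in> nonzero_submods D" "F \<in> nonzero_submods D"
  shows "submod_mult D E F \<in> nonzero_submods D"
proof -
  obtain x y where "x \<in> E" "x \<noteq> 0" "y \<in> F" "y \<noteq> 0"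
    using assms nonzero_submodsE by metis
  then show ?thesis
    by (intro nonzero_submodsI[of _ _ "x * y"]) (auto intro: submod_submod_mult submod_mult_mem)
qed

text \<open>Directedness argument shared by products and closures: choose a finite witness for each
  element of \<open>S\<close> and take the union of the witnesses, which is still finite.\<close>

lemma finite_subset_directed:
  assumes "finite S" "\<And>s. s \<in> S \<Longrightarrow> \<exists>T. finite T \<and> T \<subseteq> E \<and> s \<in> H T"
    and mono: "\<And>T T'. T \<subseteq> T' \<Longrightarrow> T' \<subseteq> E \<Longrightarrow> finite T' \<Longrightarrow> H T \<subseteq> H T'"
  obtains T where "finite T" "T \<subseteq> E" "S \<subseteq> H T"
proof -
  obtain f where f: "\<And>s. s \<in> S \<Longrightarrow> finite (f s) \<and> f s \<subseteq> E \<and> s \<in> H (f s)"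
    using assms(2) by metis
  let ?T = "\<Union>(f ` S)"
  have T: "finite ?T" "?T \<subseteq> E" using assms(1) f by auto
  have "S \<subseteq> H ?T"
  proof
    fix s assume "s \<in> S"
    then show "s \<in> H ?T" using f mono[of "f s" ?T] T by blast
  qed
  then show thesis using that T by blast
qed

text \<open>The elements reached by finite sets \<open>T\<close> already form a submodule containing
  all products, hence exhaust \<open>E * E\<close>. Here \<open>T\<close> is a bare set of
  generators: \<open>submod_mult D T T\<close> is spanned by finitely many products, which can be
  tested one by one.\<close>

lemma submod_mult_finite:
  assumes "finite S" "S \<subseteq> submod_mult D E E"
  obtains T where "finite T" "T \<subseteq> E" "S \<subseteq> submod_mult D T T"
proof (rule finite_subset_directed[of S E "\<lambda>T. submod_mult D T T"])
  let ?Z = "{z. \<exists>T. finite T \<and> T \<subseteq> E \<and> z \<in> submod_mult D T T}"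
  have "x + y \<in> ?Z" if xy: "x \<in> ?Z" "y \<in> ?Z" for x y
  proof -
    obtain T T' where T: "finite T" "T \<subseteq> E" "x \<in> submod_mult D T T"
      and T': "finite T'" "T' \<subseteq> E" "y \<in> submod_mult D T' T'"
      using xy by blast
    have "x \<in> submod_mult D (T \<union> T') (T \<union> T')" "y \<in> submod_mult D (T \<union> T') (T \<union> T')"
      using T(3) T'(3) submod_mult_mono[of _ "T \<union> T'" _ "T \<union> T'" D] by blast+
    then have "x + y \<in> submod_mult D (T \<union> T') (T \<union> T')"
      by (rule submod_add[OF submod_submod_mult])
    moreover have "finite (T \<union> T')" "T \<union> T' \<subseteq> E" using T T' by auto
    ultimately show ?thesis by blast
  qed
  moreover have "d * x \<in> ?Z" if dx: "d \<in> D" "x \<in> ?Z" for d x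
  proof -
    obtain T where T: "finite T" "T \<subseteq> E" "x \<in> submod_mult D T T" using dx by blast
    then have "d * x \<in> submod_mult D T T"
      by (intro submod_scale[OF submod_submod_mult] dx)
    then show ?thesis using T by blast
  qed
  moreover have "0 \<in> ?Z"
    using submod_zero[OF submod_submod_mult, of D "{}" "{}"] by blast
  ultimately have "submod D ?Z" by (rule submodI)
  moreover have "x * y \<in> ?Z" if xy: "x \<in> E" "y \<in> E" for x y
  proof -
    \<comment> \<open>A single set has to serve for both factors, hence the pair.\<close>
    have "x * y \<in> submod_mult D {x, y} {x, y}" by (simp add: submod_mult_mem)
    moreover have "finite {x, y}" "{x, y} \<subseteq> E" using xy by auto
    ultimately show ?thesis by blast
  qed
  ultimately have "submod_mult D E E \<subseteq> ?Z" by (rule submod_mult_subset)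
  then show "\<And>s. s \<in> S \<Longrightarrow> \<exists>T. finite T \<and> T \<subseteq> E \<and> s \<in> submod_mult D T T"
    using assms(2) by blast
  show "submod_mult D T T \<subseteq> submod_mult D T' T'" if "T \<subseteq> T'" for T T'
    using that by (intro submod_mult_mono)
qed (use assms that in auto)

lemma submod_inverse_hull:
  assumes "submod D D"
  shows "f \<in> submod_inverse D (submod D hull S) \<longleftrightarrow> (\<forall>s\<in>S. f * s \<in> D)"
proof
  assume "\<forall>s\<in>S. f * s \<in> D"
  then have "submod D hull S \<subseteq> {w. f * w \<in> D}"
    by (intro hull_minimal submod_vimage_times assms) auto
  then show "f \<in> submod_inverse D (submod D hull S)"
    unfolding submod_inverse_def by auto
qed (auto simp: submod_inverse_def hull_inc)

lemma submod_submod_inverse: "submod D D \<Longrightarrow> submod D (submod_inverse D F)"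
  unfolding submod_inverse_def submod_def by (auto simp: distrib_right mult.assoc)


subsection \<open>Semistar operations and their finite-type companions\<close>

lemma semistar_closed: "semistar_operation D c \<Longrightarrow> E \<in> nonzero_submods D \<Longrightarrow> c E \<in> nonzero_submods D"
  and semistar_times:
    "semistar_operation D c \<Longrightarrow> E \<in> nonzero_submods D \<Longrightarrow> x \<noteq> 0 \<Longrightarrow> c ((*) x ` E) = (*) x ` c E"
  and semistar_mono:
    "semistar_operation D c \<Longrightarrow> E \<in> nonzero_submods D \<Longrightarrow> F \<in> nonzero_submods D \<Longrightarrow> E \<subseteq> F \<Longrightarrow> c E \<subseteq> c F"
  and semistar_incl: "semistar_operation D c \<Longrightarrow> E \<in> nonzero_submods D \<Longrightarrow> E \<subseteq> c E"
  and semistar_idem: "semistar_operation D c \<Longrightarrow> E \<in> nonzero_submods D \<Longrightarrow> c (c E) = c E"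
  by (simp_all add: semistar_operation_def)

text \<open>The nonzero generator \<open>x\<close> keeps \<open>submod D hull S\<close> among the
  nonzero submodules, the only sets on which \<open>star\<close> is specified.\<close>

lemma finite_type_finite_character:
  assumes "z \<in> finite_type D star E"
  obtains S x where "finite S" "S \<subseteq> E" "x \<in> S" "x \<noteq> 0" "z \<in> star (submod D hull S)"
proof -
  obtain F where F: "F \<in> fg_submods D" "F \<subseteq> E" "z \<in> star F"
    using assms unfolding finite_type_def by auto
  then obtain S x where "finite S" "F = submod D hull S" "x \<in> S" "x \<noteq> 0"
    using fg_submodsE by blast
  then show thesis using that F hull_subset[of S "submod D"] by auto
qed

lemma finite_typeI:
  assumes "submod D E" "finite S" "S \<subseteq> E" "x \<in> S" "x \<noteq> 0" "z \<in> star (submod D hull S)"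
  shows "z \<in> finite_type D star E"
  using assms fg_submodsI[of S x D] hull_minimal[of S E "submod D"]
  unfolding finite_type_def by blast

lemma finite_type_mono: "E \<subseteq> F \<Longrightarrow> finite_type D star E \<subseteq> finite_type D star F"
  unfolding finite_type_def by blast

text \<open>The fact \<open>join\<close> carries the proof: finitely many elements of the closure of
  \<open>E\<close> lie in \<open>star\<close> of one finitely generated submodule of
  \<open>E\<close>, where the axioms for \<open>star\<close> apply.\<close>

lemma semistar_finite_type:
  assumes star: "semistar_operation D star"
  shows "semistar_operation D (finite_type D star)"
proof -
  let ?c = "finite_type D star"
  have join: "\<exists>T t. finite T \<and> T \<subseteq> E \<and> t \<in> T \<and> t \<noteq> 0 \<and> S \<subseteq> star (submod D hull T)"
    if E: "E \<in> nonzero_submods D" and S: "finite S" "S \<subseteq> ?c E" for E S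
  proof -
    obtain e where e: "submod D E" "e \<in> E" "e \<noteq> 0" using E nonzero_submodsE by blast
    \<comment> \<open>Inserting \<open>e\<close> makes the hull nonzero for every \<open>T\<close>,
      even the empty set, so that \<open>star\<close> is monotone in \<open>T\<close>.\<close>
    let ?H = "\<lambda>T. star (submod D hull (insert e T))"
    have mono: "?H T \<subseteq> ?H T'" if "T \<subseteq> T'" for T T'
      using that e by (intro semistar_mono[OF star] nonzero_submods_hull[of e] hull_mono) auto
    have "\<exists>T. finite T \<and> T \<subseteq> E \<and> s \<in> ?H T" if "s \<in> S" for s
    proof -
      have "s \<in> ?c E" using \<open>s \<in> S\<close> S(2) by blast
      then obtain T t where T: "finite T" "T \<subseteq> E" "t \<in> T" "t \<noteq> 0" "s \<in> star (submod D hull T)"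
        by (rule finite_type_finite_character)
      have "star (submod D hull T) \<subseteq> ?H T"
        using T by (intro semistar_mono[OF star] nonzero_submods_hull[of t] hull_mono) auto
      then show ?thesis using T by blast
    qed
    then obtain T where "finite T" "T \<subseteq> E" "S \<subseteq> ?H T"
      using finite_subset_directed[of S E ?H, OF S(1) _ mono] by blast
    then show ?thesis
      using e by (intro exI[of _ "insert e T"] exI[of _ e]) auto
  qed
  have hull_in: "submod D (star (submod D hull T))" if "t \<in> T" "t \<noteq> 0" for T t
    using semistar_closed[OF star nonzero_submods_hull[OF that]] by (auto elim: nonzero_submodsE)
  have incl: "E \<subseteq> ?c E" if E: "E \<in> nonzero_submods D" for E
  proof
    fix x assume x: "x \<in> E"
    obtain e where e: "submod D E" "e \<in> E" "e \<noteq> 0" using E nonzero_submodsE by blast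
    \<comment> \<open>Since \<open>x\<close> may be zero, it is accompanied by the nonzero
      \<open>e\<close>.\<close>
    have "submod D hull {x, e} \<in> nonzero_submods D"
      using e by (intro nonzero_submods_hull[of e]) auto
    then have "x \<in> star (submod D hull {x, e})"
      using semistar_incl[OF star] hull_subset[of "{x, e}" "submod D"] by blast
    then show "x \<in> ?c E"
      using e x by (intro finite_typeI[of _ _ "{x, e}" e]) auto
  qed
  have sub: "submod D (?c E)" if E: "E \<in> nonzero_submods D" for E
  proof -
    have sE: "submod D E" using E nonzero_submodsE by blast
    have "x + y \<in> ?c E" if xy: "x \<in> ?c E" "y \<in> ?c E" for x y
    proof -
      obtain T t where T: "finite T" "T \<subseteq> E" "t \<in> T" "t \<noteq> 0" "{x, y} \<subseteq> star (submod D hull T)"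
        using join[OF E, of "{x, y}"] xy by auto
      then have "x + y \<in> star (submod D hull T)"
        using submod_add[OF hull_in[OF T(3,4)]] by simp
      then show ?thesis by (rule finite_typeI[OF sE T(1-4)])
    qed
    moreover have "d * x \<in> ?c E" if dx: "d \<in> D" "x \<in> ?c E" for d x
    proof -
      obtain T t where T: "finite T" "T \<subseteq> E" "t \<in> T" "t \<noteq> 0" "{x} \<subseteq> star (submod D hull T)"
        using join[OF E, of "{x}"] dx by auto
      then have "d * x \<in> star (submod D hull T)"
        using submod_scale[OF hull_in[OF T(3,4)] dx(1)] by simp
      then show ?thesis by (rule finite_typeI[OF sE T(1-4)])
    qed
    moreover have "0 \<in> ?c E" using submod_zero[OF sE] incl[OF E] by blast
    ultimately show ?thesis by (rule submodI)
  qed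
  have closed: "?c E \<in> nonzero_submods D" if E: "E \<in> nonzero_submods D" for E
    using E sub[OF E] incl[OF E] by (meson nonzero_submodsE nonzero_submodsI subsetD)
  have times_le: "(*) x ` ?c E \<subseteq> ?c ((*) x ` E)" if "x \<noteq> 0" for x E
  proof
    fix z assume "z \<in> (*) x ` ?c E"
    then obtain F where F: "F \<in> fg_submods D" "F \<subseteq> E" "z \<in> (*) x ` star F"
      unfolding finite_type_def by auto
    then have "z \<in> star ((*) x ` F)"
      using semistar_times[OF star fg_submods_nonzero] \<open>x \<noteq> 0\<close> by blast
    then show "z \<in> ?c ((*) x ` E)"
      using F fg_submods_image_times[OF F(1) \<open>x \<noteq> 0\<close>] unfolding finite_type_def by blast
  qed
  have times: "?c ((*) x ` E) = (*) x ` ?c E" if x: "x \<noteq> 0" for x E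
  proof
    show "?c ((*) x ` E) \<subseteq> (*) x ` ?c E"
    proof
      fix z assume "z \<in> ?c ((*) x ` E)"
      \<comment> \<open>The reverse inclusion is \<open>times_le\<close> for the multiplier
        \<open>inverse x\<close> and the submodule \<open>xE\<close>.\<close>
      then have "inverse x * z \<in> ?c ((*) (inverse x) ` (*) x ` E)"
        using times_le[of "inverse x" "(*) x ` E"] x by auto
      then have "inverse x * z \<in> ?c E"
        using x by (simp add: image_image mult.assoc[symmetric])
      then show "z \<in> (*) x ` ?c E"
        using x by (intro image_eqI[of _ _ "inverse x * z"]) (auto simp: mult.assoc[symmetric])
    qed
  qed (use times_le x in auto)
  have idem: "?c (?c E) \<subseteq> ?c E" if E: "E \<in> nonzero_submods D" for E
  proof
    fix z assume "z \<in> ?c (?c E)"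
    then obtain S x where S: "finite S" "S \<subseteq> ?c E" "x \<in> S" "x \<noteq> 0" "z \<in> star (submod D hull S)"
      by (rule finite_type_finite_character)
    obtain T t where T: "finite T" "T \<subseteq> E" "t \<in> T" "t \<noteq> 0" "S \<subseteq> star (submod D hull T)"
      using join[OF E S(1,2)] by auto
    have N: "submod D hull T \<in> nonzero_submods D" using T nonzero_submods_hull by blast
    have "submod D hull S \<subseteq> star (submod D hull T)"
      using T hull_in by (intro hull_minimal) auto
    then have "star (submod D hull S) \<subseteq> star (star (submod D hull T))"
      by (intro semistar_mono[OF star nonzero_submods_hull[OF S(3,4)] semistar_closed[OF star N]])
    then have "z \<in> star (submod D hull T)"
      using S semistar_idem[OF star N] by auto
    moreover have "submod D E" using E nonzero_submodsE by blast
    ultimately show "z \<in> ?c E" using T finite_typeI[of D E T t] by simp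
  qed
  have "?c (?c E) = ?c E" if "E \<in> nonzero_submods D" for E
    using idem[OF that] incl[OF closed[OF that]] by (rule subset_antisym)
  then show ?thesis
    using closed times incl by (simp add: semistar_operation_def finite_type_mono)
qed


subsection \<open>Prime ideals\<close>

text \<open>This is \<open>M + Dx\<close>, the ideal generated by \<open>M\<close> and
  \<open>x\<close> when \<open>M\<close> is an ideal and \<open>x \<in> D\<close>.\<close>

definition adjoin :: "'k::field set \<Rightarrow> 'k set \<Rightarrow> 'k \<Rightarrow> 'k set" where
  "adjoin D M x = {m + d * x | m d. m \<in> M \<and> d \<in> D}"

lemma ideal_adjoin:
  assumes "submod D D" "1 \<in> D" "ideal_of D M" "x \<in> D"
  shows "ideal_of D (adjoin D M x)" "M \<subseteq> adjoin D M x" "x \<in> adjoin D M x"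
proof -
  have D: "\<And>a b. a \<in> D \<Longrightarrow> b \<in> D \<Longrightarrow> a + b \<in> D" "\<And>a b. a \<in> D \<Longrightarrow> b \<in> D \<Longrightarrow> a * b \<in> D" "0 \<in> D"
    using assms(1) unfolding submod_def by auto
  have M: "\<And>a b. a \<in> M \<Longrightarrow> b \<in> M \<Longrightarrow> a + b \<in> M" "\<And>a b. a \<in> D \<Longrightarrow> b \<in> M \<Longrightarrow> a * b \<in> M" "0 \<in> M"
    "M \<subseteq> D"
    using assms(3) unfolding submod_def ideal_of_def by auto
  have "u + v \<in> adjoin D M x" if uv: "u \<in> adjoin D M x" "v \<in> adjoin D M x" for u v
  proof -
    obtain m d m' d' where "u = m + d * x" "m \<in> M" "d \<in> D" "v = m' + d' * x" "m' \<in> M" "d' \<in> D"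
      using uv unfolding adjoin_def by blast
    then show ?thesis
      unfolding adjoin_def using D M
      by (intro CollectI exI[of _ "m + m'"] exI[of _ "d + d'"]) (simp add: algebra_simps)
  qed
  moreover have "e * u \<in> adjoin D M x" if eu: "e \<in> D" "u \<in> adjoin D M x" for e u
  proof -
    obtain m d where "u = m + d * x" "m \<in> M" "d \<in> D"
      using eu unfolding adjoin_def by blast
    then show ?thesis
      unfolding adjoin_def using D M eu(1)
      by (intro CollectI exI[of _ "e * m"] exI[of _ "e * d"]) (simp add: algebra_simps)
  qed
  moreover show "M \<subseteq> adjoin D M x"
    unfolding adjoin_def using D(3) by (force intro: exI[of _ 0])
  moreover show "x \<in> adjoin D M x"
    unfolding adjoin_def using M(3) assms(2) by force
  moreover have "adjoin D M x \<subseteq> D"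
    unfolding adjoin_def using D M assms(4) by auto
  moreover have "0 \<in> adjoin D M x"
    using \<open>M \<subseteq> adjoin D M x\<close> M(3) by blast
  ultimately show "ideal_of D (adjoin D M x)"
    unfolding ideal_of_def by (blast intro: submodI)
qed

lemma adjoin_mult_mem:
  assumes M: "ideal_of D M" and D: "submod D D" and xy: "x \<in> D" "y \<in> D" "x * y \<in> M"
    and u: "u \<in> adjoin D M x" and v: "v \<in> adjoin D M y"
  shows "u * v \<in> M"
proof -
  obtain m d m' d' where u: "u = m + d * x" "m \<in> M" "d \<in> D" and v: "v = m' + d' * y" "m' \<in> M" "d' \<in> D"
    using u v unfolding adjoin_def by blast
  have sM: "submod D M" and "M \<subseteq> D" using M unfolding ideal_of_def by auto
  have "u \<in> D"
    using u xy \<open>M \<subseteq> D\<close> by (auto intro: submod_add[OF D] submod_scale[OF D])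
  moreover have "d' * y \<in> D" "d * d' \<in> D"
    using u v xy submod_scale[OF D] by auto
  \<comment> \<open>The grouping gives each summand a factor in \<open>M\<close>: \<open>m'\<close>,
    \<open>m\<close> and \<open>x * y\<close> respectively.\<close>
  moreover have "u * v = (u * m' + (d' * y) * m) + (d * d') * (x * y)"
    unfolding u v by (simp add: algebra_simps)
  ultimately show ?thesis
    using u(2) v(2) xy(3) by (auto intro!: submod_add[OF sM] submod_scale[OF sM])
qed

text \<open>A maximal ideal among those violating a suitable property \<open>Q\<close> is prime.\<close>

lemma prime_ideal_exists:
  assumes D: "submod D D" "1 \<in> D" and I: "ideal_of D I" "\<not> Q I" and QD: "Q D"
    and chain: "\<And>C. C \<noteq> {} \<Longrightarrow> subset.chain {X. ideal_of D X \<and> I \<subseteq> X} C \<Longrightarrow> Q (\<Union>C) \<Longrightarrow> \<exists>X\<in>C. Q X"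
    and mult: "\<And>M x y. ideal_of D M \<Longrightarrow> I \<subseteq> M \<Longrightarrow> x \<in> D \<Longrightarrow> y \<in> D \<Longrightarrow> x * y \<in> M \<Longrightarrow>
      Q (adjoin D M x) \<Longrightarrow> Q (adjoin D M y) \<Longrightarrow> Q M"
  obtains P where "prime_ideal_of D P" "I \<subseteq> P" "\<not> Q P"
proof -
  let ?A = "{X. ideal_of D X \<and> I \<subseteq> X \<and> \<not> Q X}"
  have "\<exists>M\<in>?A. \<forall>X\<in>?A. M \<subseteq> X \<longrightarrow> X = M"
  proof (rule subset_Zorn_nonempty)
    show "?A \<noteq> {}" using I by auto
    fix C assume C: "C \<noteq> {}" "subset.chain ?A C"
    then have tot: "\<And>X Y. X \<in> C \<Longrightarrow> Y \<in> C \<Longrightarrow> X \<subseteq> Y \<or> Y \<subseteq> X" and CA: "C \<subseteq> ?A"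
      by (auto simp: subset_chain_def)
    have sub: "\<And>X. X \<in> C \<Longrightarrow> submod D X" and "\<Union>C \<subseteq> D"
      using CA by (auto simp: ideal_of_def)
    have "x + y \<in> \<Union>C" if xy: "x \<in> \<Union>C" "y \<in> \<Union>C" for x y
    proof -
      obtain X Y where "X \<in> C" "x \<in> X" "Y \<in> C" "y \<in> Y" using xy by auto
      then show ?thesis using tot[of X Y] sub submod_add by blast
    qed
    moreover have "d * x \<in> \<Union>C" if "d \<in> D" "x \<in> \<Union>C" for d x
      using that sub submod_scale by blast
    moreover have "0 \<in> \<Union>C" using C(1) sub submod_zero by blast
    ultimately have "submod D (\<Union>C)" by (rule submodI)
    then have ideal_C: "ideal_of D (\<Union>C)"
      using \<open>\<Union>C \<subseteq> D\<close> unfolding ideal_of_def by blast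
    have chain_C: "subset.chain {X. ideal_of D X \<and> I \<subseteq> X} C"
      using C(2) by (auto simp: subset_chain_def)
    then have "\<not> Q (\<Union>C)"
      using chain[OF C(1) chain_C] CA by blast
    then show "\<Union>C \<in> ?A" using ideal_C C(1) CA by auto
  qed
  then obtain M where M: "ideal_of D M" "I \<subseteq> M" "\<not> Q M"
    and max: "\<And>X. ideal_of D X \<Longrightarrow> I \<subseteq> X \<Longrightarrow> \<not> Q X \<Longrightarrow> M \<subseteq> X \<Longrightarrow> X = M" by auto
  \<comment> \<open>Adjoining \<open>x\<close> enlarges \<open>M\<close> strictly, so maximality
    forces \<open>Q\<close>. If \<open>x * y \<in> M\<close> with both factors outside
    \<open>M\<close>, then \<open>mult\<close> would yield \<open>Q M\<close>.\<close>
  have big: "Q (adjoin D M x)" if "x \<in> D" "x \<notin> M" for x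
    using ideal_adjoin[OF D M(1) that(1)] max[of "adjoin D M x"] M(2) that(2) by blast
  have "prime_ideal_of D M"
    unfolding prime_ideal_of_def using M QD mult[OF M(1,2)] big by blast
  then show thesis using that M by blast
qed

text \<open>Consider the multiplicative set of all \<open>s * a ^ n\<close> with \<open>s\<close> in
  \<open>D\<close> outside \<open>P\<close>. If \<open>I\<close> missed it, some prime over
  \<open>I\<close> would miss it too; that prime would lie in \<open>P\<close> without containing
  \<open>a\<close>, against minimality. Radicality then removes the exponent.\<close>

lemma minimal_prime_radical:
  assumes D: "submod D D" "1 \<in> D" and I: "radical_ideal_of D I"
    and P: "P \<in> minimal_primes D I" and a: "a \<in> P"
  obtains s where "s \<in> D" "s \<notin> P" "s * a \<in> I"
proof -
  have idI: "ideal_of D I" and rad: "\<And>x n. x \<in> D \<Longrightarrow> n > 0 \<Longrightarrow> x ^ n \<in> I \<Longrightarrow> x \<in> I"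
    using I unfolding radical_ideal_of_def by auto
  have prP: "prime_ideal_of D P" and IP: "I \<subseteq> P"
    and min: "\<And>Q. prime_ideal_of D Q \<Longrightarrow> I \<subseteq> Q \<Longrightarrow> Q \<subseteq> P \<Longrightarrow> Q = P"
    using P unfolding minimal_primes_def by auto
  have "submod D P" "P \<noteq> D" "P \<subseteq> D" and pr: "\<And>a b. a \<in> D \<Longrightarrow> b \<in> D \<Longrightarrow> a * b \<in> P \<Longrightarrow> a \<in> P \<or> b \<in> P"
    using prP unfolding prime_ideal_of_def ideal_of_def by auto
  have one: "1 \<notin> P"
    using submod_scale[OF \<open>submod D P\<close>, of _ 1] \<open>P \<noteq> D\<close> \<open>P \<subseteq> D\<close> by auto
  have aD: "a \<in> D" using a \<open>P \<subseteq> D\<close> by auto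
  have pow: "a ^ n \<in> D" for n
    by (induction n) (use D aD submod_scale in auto)
  let ?Q = "\<lambda>X. \<exists>n s. s \<in> D \<and> s \<notin> P \<and> s * a ^ n \<in> X"
  have "?Q I"
  proof (rule ccontr)
    assume nQ: "\<not> ?Q I"
    obtain R where R: "prime_ideal_of D R" "I \<subseteq> R" "\<not> ?Q R"
    proof (rule prime_ideal_exists[of D I ?Q])
      show "?Q D" using D(2) one by (intro exI[of _ 0] exI[of _ 1]) auto
      show "\<exists>X\<in>C. ?Q X" if "?Q (\<Union>C)" for C using that by blast
      fix M x y assume M: "ideal_of D M" "x \<in> D" "y \<in> D" "x * y \<in> M"
        and "?Q (adjoin D M x)" "?Q (adjoin D M y)"
      then obtain n s m t where st: "s \<in> D" "s \<notin> P" "t \<in> D" "t \<notin> P"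
          "s * a ^ n \<in> adjoin D M x" "t * a ^ m \<in> adjoin D M y"
        by blast
      then have "(s * a ^ n) * (t * a ^ m) \<in> M"
        using adjoin_mult_mem[OF M(1) D(1) M(2-4)] by blast
      then have "(s * t) * a ^ (n + m) \<in> M" by (simp add: power_add algebra_simps)
      moreover have "s * t \<in> D" "s * t \<notin> P" using st pr submod_scale[OF D(1)] by blast+
      ultimately show "?Q M" by blast
    qed (use D idI nQ in auto)
    have "R \<subseteq> P"
    proof
      fix r assume r: "r \<in> R"
      then have "r \<in> D" using R(1) unfolding prime_ideal_of_def ideal_of_def by auto
      \<comment> \<open>The exponent \<open>0\<close> shows that \<open>R\<close> contains no
        element outside \<open>P\<close>.\<close>
      then show "r \<in> P" using R(3) r by (metis mult.right_neutral power_0)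
    qed
    then have "a \<in> R" using min R a by blast
    then have "1 * a ^ 1 \<in> R" by simp
    then show False using R(3) D(2) one by blast
  qed
  then obtain n s where s: "s \<in> D" "s \<notin> P" "s * a ^ n \<in> I" by blast
  have sa: "s * a \<in> D" using s aD submod_scale[OF D(1)] by blast
  \<comment> \<open>The exponent is raised to \<open>Suc n\<close> because \<open>n\<close> may be
    \<open>0\<close>, while radicality needs a positive power.\<close>
  have "(s * a) ^ Suc n = (s ^ n * a) * (s * a ^ n)"
    by (simp add: power_mult_distrib algebra_simps)
  moreover have "s ^ n \<in> D"
    by (induction n) (use D s submod_scale in auto)
  then have "s ^ n * a \<in> D" using aD submod_scale[OF D(1)] by blast
  ultimately have "(s * a) ^ Suc n \<in> I"
    using s(3) idI submod_scale unfolding ideal_of_def by metis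
  then have "s * a \<in> I" using rad[OF sa, of "Suc n"] by blast
  then show thesis using that s by blast
qed


subsection \<open>Idempotent ideals\<close>

lemma domain_submod:
  assumes "domain_with_quotient_field D"
  shows "submod D D"
proof -
  have d: "\<And>a b. a \<in> D \<Longrightarrow> b \<in> D \<Longrightarrow> a - b \<in> D" "1 \<in> D" "\<And>a b. a \<in> D \<Longrightarrow> b \<in> D \<Longrightarrow> a * b \<in> D"
    using assms by (simp_all add: domain_with_quotient_field_def)
  have 0: "0 \<in> D" using d(1)[of 1 1] d(2) by simp
  have "a + b \<in> D" if "a \<in> D" "b \<in> D" for a b
    using d(1)[of a "0 - b"] d(1)[of 0 b] that 0 by simp
  then show ?thesis using 0 d(3) by (simp add: submod_def)
qed

section \<open>Closure calculus and cancellation in a P\<star>MD\<close>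

locale finite_type_P_star_MD =
  fixes D :: "'k::field set" and star :: "'k set \<Rightarrow> 'k set"
  assumes domain: "domain_with_quotient_field D"
    and semistar: "semistar_operation D star"
    and P_star_MD: "P_star_MD D star"
begin

abbreviation c :: "'k set \<Rightarrow> 'k set" where "c \<equiv> finite_type D star"

abbreviation mult :: "'k set \<Rightarrow> 'k set \<Rightarrow> 'k set" where "mult \<equiv> submod_mult D"

lemmas semistar_c = semistar_finite_type[OF semistar]

lemma one_mem: "1 \<in> D" and mult_mem: "a \<in> D \<Longrightarrow> b \<in> D \<Longrightarrow> a * b \<in> D"
  using domain by (simp_all add: domain_with_quotient_field_def)

lemmas submod_D = domain_submod[OF domain]

lemma D_nonzero: "D \<in> nonzero_submods D"
  using submod_D one_mem by (intro nonzero_submodsI[of _ _ 1]) auto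

lemma submod_c: "E \<in> nonzero_submods D \<Longrightarrow> submod D (c E)"
  using semistar_closed[OF semistar_c] by (auto elim: nonzero_submodsE)

lemma c_least:
  assumes "E \<in> nonzero_submods D" "X \<in> nonzero_submods D" "E \<subseteq> c X"
  shows "c E \<subseteq> c X"
  using semistar_mono[OF semistar_c assms(1) semistar_closed[OF semistar_c assms(2)] assms(3)]
    semistar_idem[OF semistar_c assms(2)] by simp

text \<open>Scaling commutes with the closure, so \<open>yE \<subseteq> c X\<close> passes to
  \<open>c E\<close>. The scaling axiom excludes \<open>y = 0\<close>, which is treated
  separately.\<close>

lemma c_times_mem:
  assumes E: "E \<in> nonzero_submods D" and X: "X \<in> nonzero_submods D"
    and y: "\<And>e. e \<in> E \<Longrightarrow> y * e \<in> c X" and z: "z \<in> c E"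
  shows "y * z \<in> c X"
proof (cases "y = 0")
  case True
  then show ?thesis using submod_zero[OF submod_c[OF X]] by simp
next
  case False
  have "c ((*) y ` E) \<subseteq> c X"
    using E X y False by (intro c_least nonzero_submods_image_times) auto
  then show ?thesis using z semistar_times[OF semistar_c E False] by auto
qed

text \<open>With \<open>L\<close> generated by \<open>S\<close>, the P\<star>MD property puts
  \<open>1\<close> into the closure of \<open>L * L^-1\<close>. The assumption extends from
  generators to all of that product, so multiplying by \<open>z\<close> sends \<open>1\<close> into
  \<open>c X\<close>.\<close>

lemma c_cancel:
  assumes S: "finite S" "s\<^sub>0 \<in> S" "s\<^sub>0 \<noteq> 0" and X: "X \<in> nonzero_submods D"
    and z: "\<And>s f. s \<in> S \<Longrightarrow> (\<And>t. t \<in> S \<Longrightarrow> f * t \<in> D) \<Longrightarrow> z * (s * f) \<in> c X"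
  shows "z \<in> c X"
proof -
  define L where "L = submod D hull S"
  let ?E = "mult L (submod_inverse D L)"
  have "L \<in> fg_submods D" unfolding L_def using S by (rule fg_submodsI)
  then have "c ?E = c D" using P_star_MD unfolding P_star_MD_def by blast
  then have one: "1 \<in> c ?E" using semistar_incl[OF semistar_c D_nonzero] one_mem by auto
  \<comment> \<open>The closure of \<open>?E\<close> contains \<open>1\<close>, so \<open>?E\<close>
    has a finite subset with a nonzero member.\<close>
  then have E: "?E \<in> nonzero_submods D"
    by (metis finite_type_finite_character nonzero_submodsI submod_submod_mult subsetD)
  have "z * (l * f) \<in> c X" if f: "f \<in> submod_inverse D L" and l: "l \<in> L" for l f
  proof -
    have "L \<subseteq> {w. (z * f) * w \<in> c X}"
      unfolding L_def
    proof (intro hull_minimal submod_vimage_times submod_c X subsetI CollectI)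
      fix s assume "s \<in> S"
      then show "(z * f) * s \<in> c X"
        using z[of s f] f unfolding L_def submod_inverse_hull[OF submod_D]
        by (simp add: mult.commute mult.left_commute)
    qed
    then have "(z * f) * l \<in> c X" using l by blast
    then show ?thesis by (simp add: mult.assoc mult.commute[of l])
  qed
  then have "?E \<subseteq> {w. z * w \<in> c X}"
    by (intro submod_mult_subset submod_vimage_times submod_c X CollectI)
  then have "z * 1 \<in> c X" by (intro c_times_mem[OF E X _ one]) blast
  then show ?thesis by simp
qed

text \<open>The set \<open>T\<close> generates the ideal \<open>J\<close> of the overview; its
  nonzero element \<open>t\<close> is what \<open>c_cancel\<close> asks for.\<close>

lemma c_square_finite:
  assumes E: "E \<in> nonzero_submods D" and z: "z \<in> c (mult E E)"
  obtains T t where "finite T" "T \<subseteq> E" "t \<in> T" "t \<noteq> 0" "z \<in> c (mult T T)"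
    "mult T T \<in> nonzero_submods D"
proof -
  obtain S x where S: "finite S" "S \<subseteq> mult E E" "x \<in> S" "x \<noteq> 0" "z \<in> star (submod D hull S)"
    using z by (rule finite_type_finite_character)
  obtain T where T: "finite T" "T \<subseteq> E" "S \<subseteq> mult T T"
    using S(1,2) by (rule submod_mult_finite)
  obtain e where e: "submod D E" "e \<in> E" "e \<noteq> 0" using E nonzero_submodsE by blast
  let ?T = "insert e T"
  have "S \<subseteq> mult ?T ?T" using T(3) submod_mult_mono[of T ?T T ?T D] by blast
  then have "z \<in> c (mult ?T ?T)"
    using S by (intro finite_typeI[of D "mult ?T ?T" S x] submod_submod_mult)
  moreover have "mult ?T ?T \<in> nonzero_submods D"
    using \<open>S \<subseteq> mult ?T ?T\<close> S(3,4) by (intro nonzero_submodsI[OF submod_submod_mult]) auto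
  ultimately show thesis using that[of ?T e] T e by auto
qed

text \<open>Since \<open>I * I \<subseteq> I\<close>, only one inclusion has content, and
  idempotence is used in that form from here on.\<close>

lemma star_idempotent_iff:
  assumes I: "ideal_of D I" "I \<noteq> {0}"
  shows "star_idempotent D c I \<longleftrightarrow> I \<subseteq> c (mult I I)"
proof -
  have N: "I \<in> nonzero_submods D" and sub: "submod D I" "I \<subseteq> D"
    using I unfolding ideal_of_def nonzero_submods_def by auto
  have NN: "mult I I \<in> nonzero_submods D" using N N by (rule nonzero_submods_mult)
  have "c (mult I I) \<subseteq> c I"
    using sub by (intro finite_type_mono submod_mult_subset) (auto intro: submod_scale)
  then show ?thesis
    unfolding star_idempotent_def using N NN c_least[OF N NN] semistar_incl[OF semistar_c N] by auto
qed

section \<open>Idempotent ideals: radicality and minimal primes\<close>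

lemma idempotent_imp_radical:
  assumes I: "quasi_star_ideal D c I" and idem: "I \<subseteq> c (mult I I)"
  shows "radical_ideal_of D I"
proof -
  have idI: "ideal_of D I" and N: "I \<in> nonzero_submods D" and sub: "submod D I" "I \<subseteq> D"
    and quasi: "I = c I \<inter> D"
    using I unfolding quasi_star_ideal_def ideal_of_def nonzero_submods_def by auto
  have square: "x \<in> I" if x: "x \<in> D" "x ^ 2 \<in> I" for x
  proof -
    have "x ^ 2 \<in> c (mult I I)" using x idem by blast
    then obtain T t where T: "finite T" "T \<subseteq> I" "t \<in> T" "t \<noteq> 0" "x ^ 2 \<in> c (mult T T)"
      and TT: "mult T T \<in> nonzero_submods D"
      using c_square_finite[OF N] by metis
    have "x \<in> c I"
    \<comment> \<open>Cancel \<open>J + xD\<close>. For a generator \<open>s \<in> T\<close>, the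
      factor \<open>f * x\<close> lies in \<open>D\<close>. For \<open>s = x\<close>, the element is
      \<open>f * x ^ 2\<close>, and \<open>f\<close> maps the product of two elements of
      \<open>T\<close> into \<open>I\<close>.\<close>
    proof (rule c_cancel[of "insert x T" t])
      fix s f assume s: "s \<in> insert x T" and f: "\<And>t. t \<in> insert x T \<Longrightarrow> f * t \<in> D"
      show "x * (s * f) \<in> c I"
      proof (cases "s \<in> T")
        case True
        then have "(f * x) * s \<in> I" using T(2) f submod_scale[OF sub(1)] by blast
        then show ?thesis
          using semistar_incl[OF semistar_c N] by (auto simp: mult.commute mult.left_commute)
      next
        case False
        have "mult T T \<subseteq> {w. f * w \<in> I}"
        proof (intro submod_mult_subset submod_vimage_times sub CollectI)
          fix a b assume "a \<in> T" "b \<in> T"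
          then have "(f * a) * b \<in> I" using T(2) f submod_scale[OF sub(1)] by blast
          then show "f * (a * b) \<in> I" by (simp add: mult.assoc)
        qed
        then have "f * x ^ 2 \<in> c I"
          using semistar_incl[OF semistar_c N] by (intro c_times_mem[OF TT N _ T(5)]) auto
        then show ?thesis using False s by (simp add: power2_eq_square mult.commute mult.left_commute)
      qed
    qed (use T N in auto)
    then show ?thesis using quasi x by blast
  qed
  have pow: "x ^ n \<in> D" if "x \<in> D" for x n
    by (induction n) (use that one_mem mult_mem in auto)
  have "x \<in> I" if "x \<in> D" "n > 0" "x ^ n \<in> I" for x n
    using that(2,3)
  proof (induction n rule: less_induct)
    case (less n)
    show ?case
    proof (cases "n = 1")
      case False
      \<comment> \<open>Half of \<open>n\<close> rounded up: \<open>2 * ?m \<ge> n\<close> makes the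
        square of \<open>x ^ ?m\<close> a multiple of \<open>x ^ n\<close>, and
        \<open>?m < n\<close> as soon as \<open>n > 1\<close>.\<close>
      let ?m = "(n + 1) div 2"
      have "(x ^ ?m) ^ 2 = x ^ (2 * ?m - n) * x ^ n"
        by (simp add: power_mult[symmetric] power_add[symmetric] mult.commute)
      then have "(x ^ ?m) ^ 2 \<in> I"
        using less.prems(2) submod_scale[OF sub(1) pow[OF that(1)]] by simp
      then have "x ^ ?m \<in> I" using square pow that(1) by blast
      then show ?thesis using less.IH[of ?m] less.prems(1) False by simp
    qed (use less.prems in simp)
  qed
  moreover have "\<exists>n>0. x ^ n \<in> I" if "x \<in> I" for x
    using that by (intro exI[of _ 1]) auto
  ultimately show ?thesis
    unfolding radical_ideal_of_def using idI sub(2) by auto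
qed

lemma idempotent_minimal_prime:
  assumes I: "radical_ideal_of D I" "I \<noteq> {0}" and idem: "I \<subseteq> c (mult I I)"
    and P: "P \<in> minimal_primes D I"
  shows "P \<subseteq> c (mult P P)"
proof
  fix a assume a: "a \<in> P"
  have N: "I \<in> nonzero_submods D"
    using I unfolding radical_ideal_of_def ideal_of_def nonzero_submods_def by auto
  have IP: "I \<subseteq> P" and sub: "submod D P" "P \<subseteq> D"
    and pr: "\<And>a b. a \<in> D \<Longrightarrow> b \<in> D \<Longrightarrow> a * b \<in> P \<Longrightarrow> a \<in> P \<or> b \<in> P"
    using P unfolding minimal_primes_def prime_ideal_of_def ideal_of_def by auto
  have "P \<in> nonzero_submods D"
    using N IP sub(1) by (meson nonzero_submodsE nonzero_submodsI subsetD)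
  then have PP: "mult P P \<in> nonzero_submods D" by (intro nonzero_submods_mult)
  obtain s where s: "s \<in> D" "s \<notin> P" "s * a \<in> I"
    using minimal_prime_radical[OF submod_D one_mem I(1) P a] by blast
  have "s * a \<in> c (mult I I)" using s idem by blast
  then obtain T t where T: "finite T" "T \<subseteq> I" "t \<in> T" "t \<noteq> 0" "s * a \<in> c (mult T T)"
    and TT: "mult T T \<in> nonzero_submods D"
    using c_square_finite[OF N] by metis
  show "a \<in> c (mult P P)"
  proof (rule c_cancel[of "insert s T" t])
    fix r f assume r: "r \<in> insert s T" and f: "\<And>t. t \<in> insert s T \<Longrightarrow> f * t \<in> D"
    \<comment> \<open>As \<open>f * s \<in> D\<close>, the product \<open>s * (f * u)\<close> lies
      in \<open>P\<close>; since \<open>s \<notin> P\<close>, primality gives the claim.\<close>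
    have fT: "f * u \<in> P" if u: "u \<in> T" for u
    proof -
      have "u \<in> P" using u T(2) IP by blast
      then have "(f * s) * u \<in> P" using f submod_scale[OF sub(1)] by blast
      then have "s * (f * u) \<in> P" by (simp add: mult.commute mult.left_commute)
      then show ?thesis using s pr[of s "f * u"] f u by blast
    qed
    show "a * (r * f) \<in> c (mult P P)"
    proof (cases "r \<in> T")
      case True
      then have "a * (f * r) \<in> mult P P" using a fT by (intro submod_mult_mem)
      then show ?thesis
        using semistar_incl[OF semistar_c PP] by (auto simp: mult.commute)
    next
      case False
      \<comment> \<open>Here \<open>r = s\<close>, and \<open>s * a\<close> is in the closure of
        \<open>mult T T\<close>. The multiplier \<open>f\<close> is absorbed by one factor, which
        stays in \<open>P\<close> by \<open>fT\<close>.\<close>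
      have "mult T T \<subseteq> {w. f * w \<in> mult P P}"
      proof (intro submod_mult_subset submod_vimage_times submod_submod_mult CollectI)
        fix u v assume "u \<in> T" "v \<in> T"
        then have "(f * u) * v \<in> mult P P" using fT T(2) IP by (intro submod_mult_mem) auto
        then show "f * (u * v) \<in> mult P P" by (simp add: mult.assoc)
      qed
      then have "f * (s * a) \<in> c (mult P P)"
        using semistar_incl[OF semistar_c PP] by (intro c_times_mem[OF TT PP _ T(5)]) auto
      then show ?thesis using False r by (simp add: mult.commute mult.left_commute)
    qed
  qed (use T PP in auto)
qed

section \<open>The converse: localization at a prime \<open>M\<close> with
  \<open>1 \<notin> c M\<close>\<close>

lemma prime_ideal_avoiding_one:
  assumes C: "ideal_of D C" "C \<noteq> {0}" and one: "1 \<notin> c C"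
  obtains M where "prime_ideal_of D M" "C \<subseteq> M" "1 \<notin> c M"
proof (rule prime_ideal_exists[of D C "\<lambda>X. 1 \<in> c X"])
  have nz: "X \<in> nonzero_submods D" if "ideal_of D X" "C \<subseteq> X" for X
    using that C submod_zero[of D C] unfolding ideal_of_def nonzero_submods_def by blast
  show "1 \<in> c D" using semistar_incl[OF semistar_c D_nonzero] one_mem by blast
  show "\<exists>X\<in>A. 1 \<in> c X"
    if A: "A \<noteq> {}" "subset.chain {X. ideal_of D X \<and> C \<subseteq> X} A" "1 \<in> c (\<Union>A)" for A
  proof -
    obtain S x where S: "finite S" "S \<subseteq> \<Union>A" "x \<in> S" "x \<noteq> 0" "1 \<in> star (submod D hull S)"
      using A(3) by (rule finite_type_finite_character)
    \<comment> \<open>Finite character is decisive: the finite set witnessing \<open>1\<close>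
      already lies in one member of the chain.\<close>
    obtain X where X: "X \<in> A" "S \<subseteq> X"
      using finite_subset_Union_chain[OF S(1,2) A(1,2)] by blast
    then have "submod D X" using A(2) by (auto simp: subset_chain_def ideal_of_def)
    then have "1 \<in> c X" using S X by (intro finite_typeI[of D X S x])
    then show ?thesis using X(1) by blast
  qed
  show "1 \<in> c M"
    if M: "ideal_of D M" "C \<subseteq> M" and xy: "x \<in> D" "y \<in> D" "x * y \<in> M"
      and one: "1 \<in> c (adjoin D M x)" "1 \<in> c (adjoin D M y)" for M x y
  proof -
    have N: "M \<in> nonzero_submods D" using M nz by blast
    have Nx: "adjoin D M z \<in> nonzero_submods D" if "z \<in> D" for z
      using ideal_adjoin[OF submod_D one_mem M(1) that] M(2) nz by blast
    \<comment> \<open>The closure is passed twice: for fixed \<open>u\<close>, from the elements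
      \<open>v\<close> of \<open>adjoin D M y\<close> to \<open>1\<close>, and afterwards from the
      elements \<open>u\<close> of \<open>adjoin D M x\<close> to \<open>1\<close>.\<close>
    have "1 * u \<in> c M" if u: "u \<in> adjoin D M x" for u
    proof -
      have "u * v \<in> c M" if "v \<in> adjoin D M y" for v
        using adjoin_mult_mem[OF M(1) submod_D xy u that] semistar_incl[OF semistar_c N] by blast
      then have "u * 1 \<in> c M" using c_times_mem[OF Nx N] xy(2) one(2) by blast
      then show ?thesis by simp
    qed
    then have "1 * 1 \<in> c M" using c_times_mem[OF Nx N] xy(1) one(1) by blast
    then show ?thesis by simp
  qed
qed (use C one that submod_D one_mem in auto)

text \<open>The set is the contraction of \<open>I D_M\<close> to \<open>D\<close>. That
  \<open>D_M\<close> is a valuation domain enters as divisibility: of two elements of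
  \<open>D\<close>, one divides the other up to a factor outside \<open>M\<close>.\<close>

lemma radical_localization_minimal_prime:
  assumes I: "radical_ideal_of D I" "I \<noteq> {0}" "I \<subseteq> M"
    and M: "prime_ideal_of D M" "1 \<notin> c M"
  shows "{x \<in> D. \<exists>s\<in>D - M. s * x \<in> I} \<in> minimal_primes D I"
proof -
  let ?P = "{x \<in> D. \<exists>s\<in>D - M. s * x \<in> I}"
  have sub: "submod D I" "I \<subseteq> D" and rad: "\<And>x n. x \<in> D \<Longrightarrow> n > 0 \<Longrightarrow> x ^ n \<in> I \<Longrightarrow> x \<in> I"
    using I unfolding radical_ideal_of_def ideal_of_def by auto
  have subM: "submod D M" "M \<subseteq> D"
    and pr: "\<And>a b. a \<in> D \<Longrightarrow> b \<in> D \<Longrightarrow> a * b \<in> M \<Longrightarrow> a \<in> M \<or> b \<in> M" and "M \<noteq> D"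
    using M unfolding prime_ideal_of_def ideal_of_def by auto
  have NM: "M \<in> nonzero_submods D"
    using subM I sub submod_zero[OF sub(1)] unfolding nonzero_submods_def by auto
  have one: "1 \<notin> M"
    using submod_scale[OF subM(1), of _ 1] \<open>M \<noteq> D\<close> subM(2) by auto
  have IP: "I \<subseteq> ?P" using sub(2) one one_mem by (auto intro!: bexI[of _ 1])
  have PM: "?P \<subseteq> M" using pr I(3) by blast
  have add: "x + y \<in> ?P" if xy: "x \<in> ?P" "y \<in> ?P" for x y
  proof -
    obtain s t where st: "s \<in> D" "s \<notin> M" "s * x \<in> I" "t \<in> D" "t \<notin> M" "t * y \<in> I" "x \<in> D" "y \<in> D"
      using xy by blast
    have "t * (s * x) + s * (t * y) \<in> I"
      using submod_add[OF sub(1)] submod_scale[OF sub(1)] st(1,3,4,6) by simp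
    then have "(s * t) * (x + y) \<in> I" by (simp add: algebra_simps)
    moreover have "s * t \<in> D - M" using st pr mult_mem by blast
    ultimately show ?thesis using st submod_add[OF submod_D] by blast
  qed
  have scale: "d * x \<in> ?P" if dx: "d \<in> D" "x \<in> ?P" for d x
  proof -
    obtain s where s: "s \<in> D - M" "s * x \<in> I" "x \<in> D" using dx by blast
    then have "s * (d * x) \<in> I"
      using submod_scale[OF sub(1) dx(1), of "s * x"] by (simp add: mult.left_commute)
    then show ?thesis using s dx mult_mem by blast
  qed
  \<comment> \<open>The relation with \<open>r \<notin> M\<close> says that \<open>y\<close> divides
    \<open>x\<close> in \<open>D_M\<close>. Replacing one \<open>r * x\<close> by
    \<open>r' * y\<close> in a square turns it into a multiple of \<open>x * y\<close>, and
    radicality takes the root.\<close>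
  have half: "x \<in> ?P" if x: "x \<in> D" "y \<in> D" "x * y \<in> ?P" and r: "r \<in> D - M" "r' \<in> D" "r * x = r' * y"
    for x y r r'
  proof -
    obtain s where s: "s \<in> D - M" "s * (x * y) \<in> I" using x by blast
    have "(r * s * x) ^ 2 = (r * s * r') * (s * (x * y))"
    proof -
      have "(r * s * x) ^ 2 = (r * s) * s * x * (r * x)" by (simp add: power2_eq_square algebra_simps)
      then show ?thesis unfolding r(3) by (simp add: algebra_simps)
    qed
    then have "(r * s * x) ^ 2 \<in> I"
      using s r mult_mem submod_scale[OF sub(1)] by simp
    then have "r * s * x \<in> I"
      using rad[of "r * s * x" 2] r s x(1) mult_mem by auto
    moreover have "r * s \<in> D - M" using r s pr mult_mem by blast
    ultimately show ?thesis using x(1) by blast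
  qed
  have prime: "x \<in> ?P \<or> y \<in> ?P" if xy: "x \<in> D" "y \<in> D" "x * y \<in> ?P" for x y
  proof (cases "x = 0")
    case True
    then show ?thesis using submod_zero[OF sub(1)] IP by blast
  next
    case False
    \<comment> \<open>Such an \<open>f\<close> lies in the inverse of \<open>(x, y)\<close>. If
      every such \<open>f\<close> sent both generators into \<open>M\<close>, cancelling
      \<open>(x, y)\<close> would give \<open>1 \<in> c M\<close>.\<close>
    have "\<exists>f. f * x \<in> D \<and> f * y \<in> D \<and> \<not> (f * x \<in> M \<and> f * y \<in> M)"
    proof (rule ccontr)
      assume contra: "\<not> ?thesis"
      have "1 \<in> c M"
      proof (rule c_cancel[of "{x, y}" x])
        fix s f assume "s \<in> {x, y}" and "\<And>t. t \<in> {x, y} \<Longrightarrow> f * t \<in> D"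
        then have "f * s \<in> M" using contra by blast
        then show "1 * (s * f) \<in> c M"
          using semistar_incl[OF semistar_c NM] by (auto simp: mult.commute)
      qed (use False NM in auto)
      then show False using M(2) by blast
    qed
    then obtain f where f: "f * x \<in> D" "f * y \<in> D" "f * x \<notin> M \<or> f * y \<notin> M" by blast
    \<comment> \<open>The coefficient outside \<open>M\<close> decides which of \<open>x\<close> and
      \<open>y\<close> is divisible by the other.\<close>
    have eq: "(f * y) * x = (f * x) * y" by simp
    show ?thesis
    proof (cases "f * y \<in> M")
      case False
      then show ?thesis using half[OF xy _ _ eq] f by blast
    next
      case True
      moreover have "y * x \<in> ?P" using xy(3) by (simp add: mult.commute)
      ultimately show ?thesis using half[OF xy(2,1) _ _ _ eq[symmetric]] f by blast
    qed
  qed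
  have "0 \<in> ?P" using submod_zero[OF sub(1)] IP by blast
  with add scale have "submod D ?P" by (rule submodI)
  then have "prime_ideal_of D ?P"
    unfolding prime_ideal_of_def ideal_of_def using prime one PM one_mem by blast
  moreover have "Q = ?P" if Q: "prime_ideal_of D Q" "I \<subseteq> Q" "Q \<subseteq> ?P" for Q
  proof -
    \<comment> \<open>Since \<open>Q \<subseteq> M\<close>, the multiplier \<open>s\<close> with
      \<open>s * x \<in> I\<close> is outside \<open>Q\<close>, so primality of \<open>Q\<close>
      applies.\<close>
    have "x \<in> Q" if "x \<in> ?P" for x
      using that Q PM unfolding prime_ideal_of_def by blast
    then show ?thesis using Q(3) by blast
  qed
  ultimately show ?thesis
    unfolding minimal_primes_def using IP by blast
qed

lemma radical_imp_idempotent: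
  assumes I: "radical_ideal_of D I" "I \<noteq> {0}"
    and idem: "\<And>P. P \<in> minimal_primes D I \<Longrightarrow> P \<subseteq> c (mult P P)"
  shows "I \<subseteq> c (mult I I)"
proof (rule subsetI, rule ccontr)
  fix a assume a: "a \<in> I" "a \<notin> c (mult I I)"
  have sub: "submod D I" "I \<subseteq> D" and N: "I \<in> nonzero_submods D"
    using I unfolding radical_ideal_of_def ideal_of_def nonzero_submods_def by auto
  have NN: "mult I I \<in> nonzero_submods D" using N N by (rule nonzero_submods_mult)
  \<comment> \<open>The conductor of \<open>a\<close> into the closure of \<open>I * I\<close>. Its
    closure omits \<open>1\<close>, since otherwise \<open>a * 1\<close> would lie in that
    closure.\<close>
  let ?C = "{d \<in> D. a * d \<in> c (mult I I)}"
  have "submod D (D \<inter> {d. a * d \<in> c (mult I I)})"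
    using submod_Inter[of "{D, {d. a * d \<in> c (mult I I)}}" D] submod_D
      submod_vimage_times[OF submod_c[OF NN]] by auto
  then have C: "ideal_of D ?C" unfolding ideal_of_def by (auto simp: Int_def)
  have IC: "I \<subseteq> ?C"
    using semistar_incl[OF semistar_c NN] submod_mult_mem[OF a(1)] sub(2) by blast
  then have NC: "?C \<in> nonzero_submods D"
    using C N unfolding ideal_of_def by (meson nonzero_submodsE nonzero_submodsI subsetD)
  have "1 \<notin> c ?C"
    using c_times_mem[OF NC NN, of a 1] a(2) by auto
  then obtain M where M: "prime_ideal_of D M" "?C \<subseteq> M" "1 \<notin> c M"
    using prime_ideal_avoiding_one[OF C] NC unfolding nonzero_submods_def by blast
  let ?P = "{x \<in> D. \<exists>s\<in>D - M. s * x \<in> I}"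
  have P: "?P \<in> minimal_primes D I"
    using IC M by (intro radical_localization_minimal_prime I) auto
  have pr: "\<And>a b. a \<in> D \<Longrightarrow> b \<in> D \<Longrightarrow> a * b \<in> M \<Longrightarrow> a \<in> M \<or> b \<in> M"
    and one: "1 \<notin> M"
    using M submod_scale[of D M _ 1] unfolding prime_ideal_of_def ideal_of_def by auto
  have IP: "I \<subseteq> ?P" and sP: "submod D ?P"
    using P unfolding minimal_primes_def prime_ideal_of_def ideal_of_def by auto
  have NP: "?P \<in> nonzero_submods D"
    using N IP sP by (meson nonzero_submodsE nonzero_submodsI subsetD)
  have "a \<in> c (mult ?P ?P)" using idem[OF P] IP a(1) by blast
  then obtain T where T: "finite T" "T \<subseteq> ?P" "a \<in> c (mult T T)"
    and TT: "mult T T \<in> nonzero_submods D"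
    by (rule c_square_finite[OF NP])
  \<comment> \<open>A common multiplier is the product of those for the finitely many
    \<open>t\<close>; primality keeps it outside \<open>M\<close>.\<close>
  have "\<exists>s\<in>D - M. \<forall>t\<in>T. s * t \<in> I"
    using T(1,2)
  proof (induction T rule: finite_induct)
    case empty
    then show ?case using one one_mem by auto
  next
    case (insert t T)
    then obtain s r where s: "s \<in> D - M" "\<And>t. t \<in> T \<Longrightarrow> s * t \<in> I" and r: "r \<in> D - M" "r * t \<in> I"
      by auto
    have "s * (r * t) \<in> I" using s r submod_scale[OF sub(1)] by blast
    moreover have "r * (s * u) \<in> I" if "u \<in> T" for u
      using that s r submod_scale[OF sub(1)] by blast
    ultimately have "\<forall>u\<in>insert t T. (s * r) * u \<in> I"
      by (auto simp: mult.assoc mult.left_commute)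
    moreover have "s * r \<in> D - M" using s r pr mult_mem by blast
    ultimately show ?case by blast
  qed
  then obtain s where s: "s \<in> D - M" "\<And>t. t \<in> T \<Longrightarrow> s * t \<in> I" by blast
  \<comment> \<open>Each of the two factors uses up one \<open>s\<close>, hence the square. It puts
    \<open>s * s\<close> into \<open>?C \<subseteq> M\<close>.\<close>
  have "mult T T \<subseteq> {w. (s * s) * w \<in> mult I I}"
  proof (intro submod_mult_subset submod_vimage_times submod_submod_mult CollectI)
    fix u v assume "u \<in> T" "v \<in> T"
    then have "(s * u) * (s * v) \<in> mult I I" using s by (intro submod_mult_mem)
    then show "(s * s) * (u * v) \<in> mult I I" by (simp add: algebra_simps)
  qed
  then have "(s * s) * a \<in> c (mult I I)"
    using semistar_incl[OF semistar_c NN] by (intro c_times_mem[OF TT NN _ T(3)]) auto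
  then have "s * s \<in> M" using s mult_mem M(2) by (auto simp: mult.commute)
  then show False using s pr by blast
qed

lemma star_idempotent_iff_radical:
  assumes I: "quasi_star_ideal D c I"
  shows "star_idempotent D c I \<longleftrightarrow>
    radical_ideal_of D I \<and> (\<forall>P\<in>minimal_primes D I. star_idempotent D c P)"
proof -
  have idI: "ideal_of D I" "I \<noteq> {0}"
    using I unfolding quasi_star_ideal_def by auto
  have "ideal_of D P \<and> P \<noteq> {0}" if "P \<in> minimal_primes D I" for P
    using that idI unfolding minimal_primes_def prime_ideal_of_def ideal_of_def
    by (auto dest: submod_zero)
  then have "star_idempotent D c P \<longleftrightarrow> P \<subseteq> c (mult P P)" if "P \<in> minimal_primes D I" for P
    using that star_idempotent_iff by blast
  then show ?thesis
    using star_idempotent_iff[OF idI] idempotent_imp_radical[OF I]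
      idempotent_minimal_prime[OF _ idI(2)] radical_imp_idempotent[OF _ idI(2)] by blast
qed

end


subsection \<open>The \<open>t\<close>-operation\<close>

lemma submod_inverse_image_times:
  assumes "x \<noteq> (0::'k::field)"
  shows "submod_inverse D ((*) x ` E) = (*) (inverse x) ` submod_inverse D E"
proof -
  have "u \<in> (*) (inverse x) ` submod_inverse D E" if u: "u \<in> submod_inverse D ((*) x ` E)" for u
  proof (rule image_eqI[of _ _ "x * u"])
    show "u = inverse x * (x * u)" using assms by simp
    show "x * u \<in> submod_inverse D E"
      using u by (auto simp: submod_inverse_def mult.commute mult.left_commute)
  qed
  moreover have eq: "inverse x * u * (x * e) = u * e" for u e
    using assms by (simp add: field_simps)
  have "(*) (inverse x) ` submod_inverse D E \<subseteq> submod_inverse D ((*) x ` E)"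
    by (auto simp: submod_inverse_def eq)
  ultimately show ?thesis by blast
qed

lemma submod_inverse_antimono: "E \<subseteq> F \<Longrightarrow> submod_inverse D F \<subseteq> submod_inverse D E"
  unfolding submod_inverse_def by auto

lemma v_closure_incl: "E \<subseteq> v_closure D E"
  unfolding v_closure_def submod_inverse_def by (auto simp: mult.commute)

lemma v_closure_mono: "E \<subseteq> F \<Longrightarrow> v_closure D E \<subseteq> v_closure D F"
  unfolding v_closure_def by (intro submod_inverse_antimono)

lemma v_closure_idem: "v_closure D (v_closure D E) = v_closure D E"
proof
  \<comment> \<open>Three inversions contain one; inverting this inclusion once more gives the
    claim.\<close>
  have "submod_inverse D E \<subseteq> submod_inverse D (v_closure D E)"
    using v_closure_incl[of "submod_inverse D E" D] unfolding v_closure_def .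
  then show "v_closure D (v_closure D E) \<subseteq> v_closure D E"
    by (subst (1 3) v_closure_def) (rule submod_inverse_antimono)
qed (rule v_closure_incl)

text \<open>The formula covers all nonzero submodules: when \<open>E\<close> is not fractional, its
  inverse is \<open>{0}\<close> and its \<open>v\<close>-closure is all of \<open>K\<close>.\<close>

lemma semistar_v_closure:
  assumes "submod D D"
  shows "semistar_operation D (v_closure D)"
proof -
  have "v_closure D E \<in> nonzero_submods D" if E: "E \<in> nonzero_submods D" for E
  proof -
    obtain e where "e \<in> E" "e \<noteq> 0" using E nonzero_submodsE by blast
    then show ?thesis
      using v_closure_incl[of E D] submod_submod_inverse[OF assms]
      by (intro nonzero_submodsI[of _ _ e]) (auto simp: v_closure_def)
  qed
  moreover have "v_closure D ((*) x ` E) = (*) x ` v_closure D E" if "x \<noteq> 0" for x E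
    using that by (simp add: v_closure_def submod_inverse_image_times)
  ultimately show ?thesis
    unfolding semistar_operation_def
    by (auto simp: v_closure_idem intro: subsetD[OF v_closure_mono] subsetD[OF v_closure_incl])
qed

section \<open>PvMDs as P\<star>MDs for the \<open>v\<close>-operation\<close>

lemma t_closure_eq_finite_type: "t_closure D = finite_type D (v_closure D)"
  unfolding t_closure_def finite_type_def by (rule refl)

lemma v_closure_domain:
  assumes "submod D D" "1 \<in> D"
  shows "v_closure D D = D"
proof -
  have "submod_inverse D D = D"
    using assms submod_scale[OF assms(1)] unfolding submod_inverse_def by force
  then show ?thesis unfolding v_closure_def by simp
qed

lemma t_closure_domain:
  assumes "submod D D" "1 \<in> D"
  shows "t_closure D D = D"
proof
  show "t_closure D D \<subseteq> D"
    unfolding t_closure_def using v_closure_mono v_closure_domain[OF assms] by blast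
  have "D \<in> nonzero_submods D" using assms by (intro nonzero_submodsI[of _ _ 1]) auto
  then show "D \<subseteq> t_closure D D"
    unfolding t_closure_eq_finite_type
    by (rule semistar_incl[OF semistar_finite_type[OF semistar_v_closure[OF assms(1)]]])
qed

text \<open>Bridges the two definitions: \<open>PvMD\<close> tests finitely generated submodules
  inside \<open>D\<close>, \<open>P_star_MD\<close> tests those of \<open>K\<close>.\<close>

lemma fg_submods_common_denominator:
  assumes dom: "domain_with_quotient_field D" and F: "F \<in> fg_submods D"
  obtains d where "d \<noteq> 0" "(*) d ` F \<subseteq> D"
proof -
  have D: "submod D D" using dom by (rule domain_submod)
  obtain S where S: "finite S" "F = submod D hull S" using F fg_submodsE by blast
  have "\<exists>d\<in>D. d \<noteq> 0 \<and> (\<forall>s\<in>S. d * s \<in> D)"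
    using S(1)
  proof (induction S rule: finite_induct)
    case empty
    then show ?case using dom by (intro bexI[of _ 1]) (simp_all add: domain_with_quotient_field_def)
  next
    case (insert s S)
    then obtain d where d: "d \<in> D" "d \<noteq> 0" "\<And>t. t \<in> S \<Longrightarrow> d * t \<in> D" by auto
    obtain a b where ab: "a \<in> D" "b \<in> D" "b \<noteq> 0" "s = a / b"
      using dom unfolding domain_with_quotient_field_def by blast
    have "b * d * s = d * a" using ab by simp
    then have "b * d * s \<in> D" using submod_scale[OF D d(1) ab(1)] by (rule ssubst)
    moreover have "b * d * t \<in> D" if "t \<in> S" for t
      using submod_scale[OF D ab(2) d(3)[OF that]] by (simp add: mult.assoc)
    moreover have "b * d \<in> D" using submod_scale[OF D] ab d by blast
    ultimately show ?case using ab d by (intro bexI[of _ "b * d"]) auto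
  qed
  then obtain d where d: "d \<noteq> 0" "\<And>s. s \<in> S \<Longrightarrow> d * s \<in> D" by blast
  have "F \<subseteq> {w. d * w \<in> D}"
    unfolding S(2) using d by (intro hull_minimal submod_vimage_times D) auto
  then show thesis using that d by blast
qed

text \<open>Scaling \<open>F\<close> by \<open>d\<close> scales its inverse by
  \<open>inverse d\<close>, so the product of the two is unchanged and \<open>F\<close> may be moved
  into \<open>D\<close>.\<close>

lemma PvMD_imp_P_star_MD:
  assumes dom: "domain_with_quotient_field D" and "PvMD D"
  shows "P_star_MD D (v_closure D)"
  unfolding P_star_MD_def t_closure_eq_finite_type[symmetric]
proof
  fix F assume F: "F \<in> fg_submods D"
  obtain d where d: "d \<noteq> 0" "(*) d ` F \<subseteq> D"
    using fg_submods_common_denominator[OF dom F] by blast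
  let ?F = "(*) d ` F"
  have "{x * y |x y. x \<in> ?F \<and> y \<in> submod_inverse D ?F} =
      {x * y |x y. x \<in> F \<and> y \<in> submod_inverse D F}" (is "?A = ?B")
  proof -
    have eq: "(d * x) * (inverse d * y) = x * y" for x y using d(1) by simp
    show ?thesis
    proof (intro subset_antisym subsetI)
      fix z assume "z \<in> ?A"
      then obtain x y where "x \<in> F" "y \<in> submod_inverse D F" "z = (d * x) * (inverse d * y)"
        unfolding submod_inverse_image_times[OF d(1)] by blast
      then show "z \<in> ?B" unfolding eq by blast
    next
      fix z assume "z \<in> ?B"
      then obtain x y where xy: "x \<in> F" "y \<in> submod_inverse D F" "z = x * y" by blast
      then have "z = (d * x) * (inverse d * y)" unfolding eq by blast
      then show "z \<in> ?A"
        unfolding submod_inverse_image_times[OF d(1)] using xy by blast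
    qed
  qed
  then have "submod_mult D ?F (submod_inverse D ?F) = submod_mult D F (submod_inverse D F)"
    unfolding submod_mult_def by simp
  moreover have "t_closure D (submod_mult D ?F (submod_inverse D ?F)) = D"
    using assms(2) d fg_submods_image_times[OF F d(1)] unfolding PvMD_def by blast
  moreover have "t_closure D D = D"
    using dom by (intro t_closure_domain domain_submod) (simp_all add: domain_with_quotient_field_def)
  ultimately show "t_closure D (submod_mult D F (submod_inverse D F)) = t_closure D D" by simp
qed

lemma t_idempotent_iff:
  "t_idempotent D I \<longleftrightarrow> ideal_of D I \<and> star_idempotent D (finite_type D (v_closure D)) I"
  unfolding t_idempotent_def star_idempotent_def t_closure_eq_finite_type ideal_of_def
    nonzero_submods_def by auto

theorem corollary2p10:
  fixes D :: "'k::field set"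
  assumes "domain_with_quotient_field D"
  shows "(\<forall>star I. semistar_operation D star \<and> P_star_MD D star \<and>
            quasi_star_ideal D (finite_type D star) I \<longrightarrow>
            (star_idempotent D (finite_type D star) I \<longleftrightarrow>
              radical_ideal_of D I \<and>
              (\<forall>P\<in>minimal_primes D I. star_idempotent D (finite_type D star) P)))
       \<and> (\<forall>I. PvMD D \<and> t_ideal D I \<longrightarrow>
            (t_idempotent D I \<longleftrightarrow>
              radical_ideal_of D I \<and> (\<forall>P\<in>minimal_primes D I. t_idempotent D P)))"
proof (intro conjI allI impI)
  fix star I
  assume H: "semistar_operation D star \<and> P_star_MD D star \<and> quasi_star_ideal D (finite_type D star) I"
  then interpret finite_type_P_star_MD D star
    using assms by unfold_locales auto
  show "star_idempotent D (finite_type D star) I \<longleftrightarrow> radical_ideal_of D I \<and>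
      (\<forall>P\<in>minimal_primes D I. star_idempotent D (finite_type D star) P)"
    using H star_idempotent_iff_radical by blast
next
  fix I assume H: "PvMD D \<and> t_ideal D I"
  then interpret finite_type_P_star_MD D "v_closure D"
    using assms by unfold_locales
      (auto intro: semistar_v_closure domain_submod PvMD_imp_P_star_MD)
  have "quasi_star_ideal D (finite_type D (v_closure D)) I" and "ideal_of D I"
    using H unfolding t_ideal_def quasi_star_ideal_def t_closure_eq_finite_type ideal_of_def by auto
  \<comment> \<open>\<open>t_idempotent\<close> includes being an ideal of \<open>D\<close>, which
    \<open>star_idempotent\<close> does not.\<close>
  moreover have "\<forall>P\<in>minimal_primes D I. ideal_of D P"
    unfolding minimal_primes_def prime_ideal_of_def by auto
  ultimately show "t_idempotent D I \<longleftrightarrow>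
      radical_ideal_of D I \<and> (\<forall>P\<in>minimal_primes D I. t_idempotent D P)"
    unfolding t_idempotent_iff using star_idempotent_iff_radical by blast
qed

end
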